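(* For every cardinal $k$, the Boolean group $G = C_2^{(k)}$ is natural.
   Context: $C_2^{(k)}$ denotes the direct sum of $k$ copies of the cyclic group $C_2$ of order $2$ (families with all but finitely many entries trivial). A group $(G,* )$ is called natural if there exists a metric $d$ on the set $G$ such that (i) all right translations $x \mapsto x*a$ ($a \in G$) are isometries of $(G,d)$, and (ii) every group structure $(G,\circ)$ on the same set $G$ for which all right translations $x \mapsto x \circ a$ are isometries of $(G,d)$ is isomorphic as a group to $(G,* )$. *)

theory Defs
  imports
    "HOL-Analysis.Abstract_Metric_Spaces"
    "HOL-Algebra.Elementary_Groups"
    "HOL-Algebra.Product_Groups"
begin

definition self_isometry :: "'a set \<Rightarrow> ('a \<Rightarrow> 'a \<Rightarrow> real) \<Rightarrow> ('a \<Rightarrow> 'a) \<Rightarrow> bool" where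
  "self_isometry M d f \<longleftrightarrow> bij_betw f M M \<and> (\<forall>x\<in>M. \<forall>y\<in>M. d (f x) (f y) = d x y)"

definition right_translations_isometric ::
    "('a, 'b) monoid_scheme \<Rightarrow> ('a \<Rightarrow> 'a \<Rightarrow> real) \<Rightarrow> bool" where
  "right_translations_isometric G d \<longleftrightarrow>
     (\<forall>a\<in>carrier G. self_isometry (carrier G) d (\<lambda>x. x \<otimes>\<^bsub>G\<^esub> a))"

definition natural_group :: "'a monoid \<Rightarrow> bool" where
  "natural_group G \<longleftrightarrow>
     group G \<and>
     (\<exists>d. Metric_space (carrier G) d \<and>
          right_translations_isometric G d \<and>
          (\<forall>H :: 'a monoid.
             group H \<and> carrier H = carrier G \<and> right_translations_isometric H d \<longrightarrow> H \<cong> G))"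

text \<open>A cardinal is represented by an arbitrary index set \<open>I\<close> of that cardinality.\<close>

definition boolean_group :: "'i set \<Rightarrow> ('i \<Rightarrow> int) monoid" where
  "boolean_group I = sum_group I (\<lambda>_. integer_mod_group 2)"

lemma carrier_boolean_group:
  "carrier (boolean_group I) = {x \<in> I \<rightarrow>\<^sub>E {0..<2}. finite {i \<in> I. x i \<noteq> 0}}"
  unfolding boolean_group_def
  by (subst carrier_sum_group) (simp_all add: carrier_integer_mod_group)

lemma group_boolean_group: "group (boolean_group I)"
  by (simp add: boolean_group_def)

end

theory Submission
  imports Defs "HOL-Library.Countable"
begin

text \<open>
  A translation-invariant metric on a group \<open>G\<close> witnesses naturality as soon as the identity is its
  only self-isometry fixing the neutral element: then every self-isometry is a right translation of
  \<open>G\<close>, which leaves any competing group structure no freedom (\<open>natural_groupI_rigid\<close>). So the task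
  is to put such a rigid metric on the Boolean group over \<open>I\<close>, that is, on the finite subsets of \<open>I\<close>
  under symmetric difference. A translation-invariant metric is a function of the symmetric difference
  of its two arguments, and if its nonzero values lie between 1 and 2 the triangle inequality is
  automatic; hence any function from finite sets to a countable set of codes can be turned into a
  metric. When \<open>I\<close> is larger than the continuum the codes cannot separate the points, so rigidity has
  to come from the way the codes of different pairs fit together.

  The code of a set contains its cardinality. An isometry fixing the empty set then permutes the
  singletons, and it is determined by the permutation \<open>\<sigma>\<close> of \<open>I\<close> so obtained, because \<open>b \<in> X\<close> holds iff
  \<open>X\<close> loses cardinality when \<open>{b}\<close> is added to it. It remains to choose the rest of the code such that
  \<open>\<sigma>\<close> must be the identity. A well-ordering of \<open>I\<close> has no nontrivial automorphisms, but the code of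
  an unordered pair cannot say which element is the smaller one. The remedy is to colour \<open>I\<close> with two
  colours, alternating along successors in the well-ordering. For a pair of differently coloured
  elements the two can be told apart, so one bit records whether the one of the first colour is the
  smaller. The colours together with these comparisons are still rigid
  (\<open>parity_comparison_rigid\<close>), because between two elements of equal colour there is always one of
  the other colour.
\<close>

section \<open>Metrics in which only the identity fixes the neutral element\<close>

lemma self_isometry_compose:
  assumes "self_isometry M d f" and "self_isometry M d g"
  shows "self_isometry M d (g \<circ> f)"
  using assms bij_betw_trans[of f M M g M] bij_betwE[of f M M]
  unfolding self_isometry_def by simp

text \<open>
  If \<open>H\<close> is a second group structure with isometric right translations, then following \<open>\<cdot>\<^sub>G \<one>\<^sub>H\<close> and
  \<open>\<cdot>\<^sub>H a\<close> by \<open>\<cdot>\<^sub>G a\<^sup>-\<^sup>1\<close> gives an isometry that fixes \<open>\<one>\<^sub>G\<close>. By rigidity it is the identity, which says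
  \<open>(x \<cdot>\<^sub>G \<one>\<^sub>H) \<cdot>\<^sub>H a = x \<cdot>\<^sub>G a\<close>. For \<open>a\<close> of the form \<open>y \<cdot>\<^sub>G \<one>\<^sub>H\<close> this is the homomorphism law for the map
  \<open>x \<mapsto> x \<cdot>\<^sub>G \<one>\<^sub>H\<close>.
\<close>

lemma natural_groupI_rigid:
  fixes G :: "'a monoid"
  assumes "group G"
    and metric: "Metric_space (carrier G) d"
    and trans: "right_translations_isometric G d"
    and rigid: "\<And>g x. \<lbrakk>self_isometry (carrier G) d g; g \<one>\<^bsub>G\<^esub> = \<one>\<^bsub>G\<^esub>; x \<in> carrier G\<rbrakk> \<Longrightarrow> g x = x"
  shows "natural_group G"
proof -
  interpret G: group G by fact
  have "H \<cong> G" if "group H" and carr: "carrier H = carrier G"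
    and H: "right_translations_isometric H d" for H :: "'a monoid"
  proof -
    interpret H: group H by fact
    let ?e = "\<one>\<^bsub>H\<^esub>"
    have e [simp, intro]: "?e \<in> carrier G"
      using H.one_closed carr by simp
    have mult: "(x \<otimes>\<^bsub>G\<^esub> ?e) \<otimes>\<^bsub>H\<^esub> a = x \<otimes>\<^bsub>G\<^esub> a" if x: "x \<in> carrier G" and a: "a \<in> carrier G" for x a
    proof -
      let ?g = "(\<lambda>x. x \<otimes>\<^bsub>G\<^esub> inv\<^bsub>G\<^esub> a) \<circ> ((\<lambda>x. x \<otimes>\<^bsub>H\<^esub> a) \<circ> (\<lambda>x. x \<otimes>\<^bsub>G\<^esub> ?e))"
      have "self_isometry (carrier G) d ?g"
        using trans H a e carr G.inv_closed
        unfolding right_translations_isometric_def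
        by (intro self_isometry_compose) auto
      moreover have "?g \<one>\<^bsub>G\<^esub> = \<one>\<^bsub>G\<^esub>"
        using a e carr by simp
      ultimately have "?g x = x"
        using rigid x by blast
      moreover have "(x \<otimes>\<^bsub>G\<^esub> ?e) \<otimes>\<^bsub>H\<^esub> a \<in> carrier G"
        using x a e carr H.m_closed by (metis G.m_closed)
      ultimately show ?thesis
        using x a G.inv_solve_right' by simp
    qed
    have "(\<lambda>x. x \<otimes>\<^bsub>G\<^esub> ?e) \<in> iso G H"
    proof (rule isoI)
      show "(\<lambda>x. x \<otimes>\<^bsub>G\<^esub> ?e) \<in> hom G H"
        by (rule homI) (simp_all add: carr mult G.m_assoc)
      show "bij_betw (\<lambda>x. x \<otimes>\<^bsub>G\<^esub> ?e) (carrier G) (carrier H)"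
        using trans e carr
        unfolding right_translations_isometric_def self_isometry_def by simp
    qed
    then show ?thesis
      using G.iso_sym is_isoI by blast
  qed
  then show ?thesis
    unfolding natural_group_def using assms by blast
qed

section \<open>Parity on a well-ordered set\<close>

text \<open>
  The parity of a limit ordinal plus \<open>n\<close> is the parity of \<open>n\<close>. If \<open>a < c\<close> have equal parity, the
  immediate successor of \<open>a\<close> has the other parity, so it is not \<open>c\<close> and lies strictly between them.
  The relation \<open>R\<close> plays the part of the strict order.
\<close>

lemma ex_alternating_parity:
  fixes R :: "('i \<times> 'i) set"
  assumes "wf R" and tot: "total_on I R" and sub: "R \<subseteq> I \<times> I"
  obtains p :: "'i \<Rightarrow> bool" where
    "\<And>a c. \<lbrakk>(a, c) \<in> R; p a = p c\<rbrakk> \<Longrightarrow> \<exists>s. (a, s) \<in> R \<and> (s, c) \<in> R \<and> p s \<noteq> p a"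
proof -
  \<comment> \<open>The least element and the limits get the value False; passing to a successor flips the value.\<close>
  define F where "F = (\<lambda>q s. \<exists>a. (a, s) \<in> R \<and> (\<forall>x. (a, x) \<in> R \<longrightarrow> (x, s) \<notin> R) \<and> \<not> q a)"
  define p where "p = wfrec R F"
  have p: "p s \<longleftrightarrow> F p s" for s
  proof -
    have "p s = F (cut p R s) s"
      unfolding p_def using wfrec[OF \<open>wf R\<close>] .
    also have "\<dots> = F p s"
      unfolding F_def cut_def by auto
    finally show ?thesis .
  qed
  have "\<exists>s. (a, s) \<in> R \<and> (s, c) \<in> R \<and> p s \<noteq> p a" if ac: "(a, c) \<in> R" and pac: "p a = p c" for a c
  proof -
    obtain s where s: "(a, s) \<in> R" and min: "\<And>x. (x, s) \<in> R \<Longrightarrow> (a, x) \<notin> R"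
      using wfE_min[OF \<open>wf R\<close>, of c "{x. (a, x) \<in> R}"] ac by auto
    have "p s = (\<not> p a)"
    proof -
      have "b = a" if "(b, s) \<in> R" "\<forall>x. (b, x) \<in> R \<longrightarrow> (x, s) \<notin> R" for b
      proof -
        have "(a, b) \<notin> R" and "(b, a) \<notin> R"
          using that s min by auto
        moreover have "a \<in> I" and "b \<in> I"
          using s that sub by auto
        ultimately show ?thesis
          using tot unfolding total_on_def by metis
      qed
      moreover have "\<forall>x. (a, x) \<in> R \<longrightarrow> (x, s) \<notin> R"
        using min by auto
      ultimately show ?thesis
        unfolding p[of s] unfolding F_def using s by metis
    qed
    moreover have "(s, c) \<in> R"
    proof -
      have "(c, s) \<notin> R" and "s \<noteq> c"
        using min[of c] ac pac calculation by auto
      moreover have "s \<in> I" and "c \<in> I"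
        using s ac sub by auto
      ultimately show ?thesis
        using tot unfolding total_on_def by metis
    qed
    ultimately show ?thesis
      using s by blast
  qed
  then show ?thesis
    by (rule that)
qed

text \<open>
  Let \<open>a\<close> be the least element moved by \<open>\<sigma>\<close>. Then \<open>a < \<sigma> a\<close>, both of the same parity, so some \<open>s\<close> of
  the other parity lies strictly between them. The preimage \<open>b\<close> of \<open>s\<close> is not below \<open>a\<close>, where \<open>\<sigma>\<close> is
  the identity, and has another parity than \<open>a\<close>; hence \<open>a < b\<close>. But \<open>\<sigma> b = s < \<sigma> a\<close>, so \<open>\<sigma>\<close> reverses
  the comparison of two elements of different parity.
\<close>

lemma parity_comparison_rigid:
  assumes "wf R" and tot: "total_on I R" and sub: "R \<subseteq> I \<times> I"
    and alt: "\<And>a c. \<lbrakk>(a, c) \<in> R; p a = p c\<rbrakk> \<Longrightarrow> \<exists>s. (a, s) \<in> R \<and> (s, c) \<in> R \<and> p s \<noteq> p a"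
    and bij: "bij_betw \<sigma> I I"
    and parity: "\<And>a. a \<in> I \<Longrightarrow> p (\<sigma> a) = p a"
    and comparison: "\<And>a b. \<lbrakk>a \<in> I; b \<in> I; p a; \<not> p b\<rbrakk> \<Longrightarrow> (\<sigma> a, \<sigma> b) \<in> R \<longleftrightarrow> (a, b) \<in> R"
    and "a \<in> I"
  shows "\<sigma> a = a"
  using \<open>wf R\<close> \<open>a \<in> I\<close>
proof (induction a rule: wf_induct_rule)
  case (less a)
  have inj: "inj_on \<sigma> I" and surj: "\<sigma> ` I = I"
    using bij by (auto simp: bij_betw_def)
  have asym: "(y, x) \<notin> R" if "(x, y) \<in> R" for x y
    using wf_not_sym[OF \<open>wf R\<close> that] .
  have below: "\<sigma> x = x" if "(x, a) \<in> R" for x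
    using less.IH that sub by blast
  have a: "\<sigma> a \<in> I"
    using surj less.prems by blast
  show ?case
  proof (rule ccontr)
    assume neq: "\<sigma> a \<noteq> a"
    have "(\<sigma> a, a) \<notin> R"
      using below inj a less.prems neq unfolding inj_on_def by blast
    then have ac: "(a, \<sigma> a) \<in> R"
      using tot a less.prems neq unfolding total_on_def by blast
    then obtain s where s: "(a, s) \<in> R" "(s, \<sigma> a) \<in> R" "p s \<noteq> p a"
      using alt parity less.prems by metis
    then obtain b where b: "b \<in> I" "s = \<sigma> b"
      using surj sub by blast
    have "p b \<noteq> p a"
      using b s parity by simp
    moreover have "(b, a) \<notin> R"
      using below b s asym by metis
    ultimately have "(a, b) \<in> R"
      using tot b less.prems unfolding total_on_def by metis
    moreover have "(\<sigma> a, \<sigma> b) \<notin> R" and "(\<sigma> b, \<sigma> a) \<in> R" and "(b, a) \<notin> R"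
      using s b asym calculation by auto
    ultimately show False
      using comparison[of a b] comparison[of b a] \<open>p b \<noteq> p a\<close> b less.prems by auto
  qed
qed

section \<open>A rigid metric on the finite subsets of a set\<close>

text \<open>
  Only sets with at most two elements matter for the two bits: on a singleton \<open>{a}\<close> the first bit is
  the parity of \<open>a\<close>, and on a pair with elements of both parities the second bit tells which one is
  smaller.
\<close>

definition set_code :: "('i \<times> 'i) set \<Rightarrow> ('i \<Rightarrow> bool) \<Rightarrow> 'i set \<Rightarrow> nat \<times> bool \<times> bool" where
  "set_code R p X = (card X, \<exists>u\<in>X. p u, \<exists>u\<in>X. \<exists>v\<in>X. p u \<and> \<not> p v \<and> (u, v) \<in> R)"

definition code_dist :: "('i \<times> 'i) set \<Rightarrow> ('i \<Rightarrow> bool) \<Rightarrow> 'i set \<Rightarrow> 'i set \<Rightarrow> real" where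
  "code_dist R p X Y =
     (if X = Y then 0 else 1 + 1 / (1 + real (to_nat (set_code R p (sym_diff X Y)))))"

lemma code_dist_bounds:
  "X \<noteq> Y \<Longrightarrow> 1 \<le> code_dist R p X Y" "code_dist R p X Y \<le> 2"
  unfolding code_dist_def by (auto simp: field_simps)

lemma code_dist_eq_0_iff: "code_dist R p X Y = 0 \<longleftrightarrow> X = Y"
  using code_dist_bounds(1)[of X Y R p] by (cases "X = Y") (simp add: code_dist_def, linarith)

lemma code_dist_nonneg: "0 \<le> code_dist R p X Y"
  unfolding code_dist_def by simp

lemma code_dist_commute: "code_dist R p X Y = code_dist R p Y X"
  unfolding code_dist_def by (auto simp: Un_commute)

lemma code_dist_triangle: "code_dist R p X Z \<le> code_dist R p X Y + code_dist R p Y Z"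
proof (cases "X = Y \<or> Y = Z")
  case True
  then show ?thesis by (auto simp: code_dist_def)
next
  case False
  then show ?thesis
    using code_dist_bounds(1)[of X Y R p] code_dist_bounds(1)[of Y Z R p]
      code_dist_bounds(2)[of R p X Z] by linarith
qed

lemma code_dist_eqD:
  assumes eq: "code_dist R p X Y = code_dist R p X' Y'"
  shows "set_code R p (sym_diff X Y) = set_code R p (sym_diff X' Y')"
proof (cases "X = Y")
  case True
  then have "X' = Y'"
    using eq code_dist_eq_0_iff by metis
  then show ?thesis using True by simp
next
  case False
  then have "X' \<noteq> Y'"
    using eq code_dist_eq_0_iff by metis
  then show ?thesis
    using eq False unfolding code_dist_def by simp
qed

text \<open>
  Membership is thereby expressed through cardinalities of symmetric differences, which an isometry
  of the code metric preserves.
\<close>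

lemma card_sym_diff_singleton_less_iff:
  assumes "finite X"
  shows "card (sym_diff X {b}) < card X \<longleftrightarrow> b \<in> X"
proof (cases "b \<in> X")
  case True
  then have "sym_diff X {b} = X - {b}" by blast
  then show ?thesis using True assms by (simp only: card_Diff1_less)
next
  case False
  then have "sym_diff X {b} = insert b X" by blast
  then show ?thesis using False assms by simp
qed

text \<open>
  The cardinality in the code makes \<open>\<phi>\<close> act on singletons by a permutation \<open>\<sigma>\<close> of \<open>I\<close>; the two bits
  make \<open>\<sigma>\<close> preserve parity and the comparisons across parities, hence trivial; and once all
  singletons are fixed, cardinalities alone determine \<open>\<phi> X\<close>.
\<close>

lemma set_code_isometry_eq_id:
  assumes R: "wf R" "total_on I R" "R \<subseteq> I \<times> I"
    and alt: "\<And>a c. \<lbrakk>(a, c) \<in> R; p a = p c\<rbrakk> \<Longrightarrow> \<exists>s. (a, s) \<in> R \<and> (s, c) \<in> R \<and> p s \<noteq> p a"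
    and bij: "bij_betw \<phi> (Fpow I) (Fpow I)"
    and code: "\<And>X Y. \<lbrakk>X \<in> Fpow I; Y \<in> Fpow I\<rbrakk> \<Longrightarrow>
      set_code R p (sym_diff (\<phi> X) (\<phi> Y)) = set_code R p (sym_diff X Y)"
    and empty: "\<phi> {} = {}"
    and X: "X \<in> Fpow I"
  shows "\<phi> X = X"
proof -
  have \<phi>_Fpow: "\<phi> Y \<in> Fpow I" if "Y \<in> Fpow I" for Y
    using bij that by (auto simp: bij_betw_def)
  have singletons: "{a} \<in> Fpow I" if "a \<in> I" for a
    using that by (simp add: Fpow_def)
  have code_\<phi>: "set_code R p (\<phi> Y) = set_code R p Y" if "Y \<in> Fpow I" for Y
    using code[OF that, of "{}"] empty by (simp add: Fpow_def)
  then have card_\<phi>: "card (\<phi> Y) = card Y" if "Y \<in> Fpow I" for Y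
    using that by (simp add: set_code_def)
  define \<sigma> where "\<sigma> a = the_elem (\<phi> {a})" for a
  have \<sigma>: "\<phi> {a} = {\<sigma> a}" if "a \<in> I" for a
  proof -
    have "card (\<phi> {a}) = 1"
      using card_\<phi>[OF singletons[OF that]] by simp
    then show ?thesis
      unfolding \<sigma>_def by (metis card_1_singletonE the_elem_eq)
  qed
  have "bij_betw \<sigma> I I"
  proof (rule bij_betw_imageI)
    show "inj_on \<sigma> I"
    proof (rule inj_onI)
      fix a b assume "a \<in> I" "b \<in> I" "\<sigma> a = \<sigma> b"
      then have "\<phi> {a} = \<phi> {b}" by (simp add: \<sigma>)
      then show "a = b"
        using bij singletons \<open>a \<in> I\<close> \<open>b \<in> I\<close> by (auto simp: bij_betw_def dest: inj_onD)
    qed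
    show "\<sigma> ` I = I"
    proof
      show "\<sigma> ` I \<subseteq> I"
        using \<sigma> \<phi>_Fpow singletons by (force simp: Fpow_def)
      show "I \<subseteq> \<sigma> ` I"
      proof
        fix b assume "b \<in> I"
        then obtain Y where Y: "Y \<in> Fpow I" "\<phi> Y = {b}"
          using bij singletons by (metis bij_betw_def imageE)
        then have "card Y = 1"
          using card_\<phi>[of Y] by simp
        then obtain a where "Y = {a}"
          by (rule card_1_singletonE)
        then show "b \<in> \<sigma> ` I"
          using Y \<sigma>[of a] by (auto simp: Fpow_def)
      qed
    qed
  qed
  moreover have "p (\<sigma> a) = p a" if "a \<in> I" for a
    using code_\<phi>[OF singletons[OF that]] \<sigma>[OF that] by (simp add: set_code_def)
  moreover have "(\<sigma> a, \<sigma> b) \<in> R \<longleftrightarrow> (a, b) \<in> R" if ab: "a \<in> I" "b \<in> I" "p a" "\<not> p b" for a b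
  proof -
    have "p (\<sigma> a)" "\<not> p (\<sigma> b)"
      using ab calculation(2) by auto
    moreover have "set_code R p (sym_diff {\<sigma> a} {\<sigma> b}) = set_code R p (sym_diff {a} {b})"
      using code[OF singletons singletons, OF ab(1,2)] \<sigma> ab by simp
    moreover have "sym_diff {u} {v} = {u, v}" if "p u" "\<not> p v" for u v
      using that by auto
    ultimately show ?thesis
      using ab by (simp add: set_code_def)
  qed
  ultimately have \<sigma>_id: "\<sigma> a = a" if "a \<in> I" for a
    using parity_comparison_rigid[OF R alt] that by blast
  have "b \<in> \<phi> X \<longleftrightarrow> b \<in> X" if "b \<in> I" for b
  proof -
    have "card (sym_diff (\<phi> X) {b}) = card (sym_diff X {b})"
      using code[OF X singletons[OF that]] \<sigma>[OF that] \<sigma>_id[OF that] by (simp add: set_code_def)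
    moreover have "finite X" "finite (\<phi> X)"
      using X \<phi>_Fpow by (auto simp: Fpow_def)
    ultimately show ?thesis
      using card_\<phi>[OF X] card_sym_diff_singleton_less_iff by metis
  qed
  then show ?thesis
    using X \<phi>_Fpow[OF X] by (auto simp: Fpow_def)
qed

section \<open>Boolean groups\<close>

definition support_on :: "'i set \<Rightarrow> ('i \<Rightarrow> int) \<Rightarrow> 'i set" where
  "support_on I x = {i \<in> I. x i \<noteq> 0}"

lemma boolean_group_value:
  assumes "x \<in> carrier (boolean_group I)" and "i \<in> I"
  shows "x i = 0 \<or> x i = 1"
proof -
  have "x i \<in> {0..<2}"
    using assms by (auto simp: carrier_boolean_group PiE_iff)
  then show ?thesis by auto
qed

lemma bij_betw_support_on: "bij_betw (support_on I) (carrier (boolean_group I)) (Fpow I)"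
proof (rule bij_betw_byWitness[where f' = "\<lambda>X. \<lambda>i\<in>I. if i \<in> X then 1 else 0"])
  show "\<forall>x\<in>carrier (boolean_group I). (\<lambda>i\<in>I. if i \<in> support_on I x then 1 else 0) = x"
  proof
    fix x assume x: "x \<in> carrier (boolean_group I)"
    then have "x \<in> extensional I"
      by (simp add: carrier_boolean_group PiE_iff)
    moreover have "(if i \<in> support_on I x then 1 else 0) = x i" if "i \<in> I" for i
      using boolean_group_value[OF x that] that by (auto simp: support_on_def)
    ultimately show "(\<lambda>i\<in>I. if i \<in> support_on I x then 1 else 0) = x"
      by (intro extensionalityI[of _ I]) simp_all
  qed
  show "\<forall>X\<in>Fpow I. support_on I (\<lambda>i\<in>I. if i \<in> X then 1 else 0) = X"
    by (auto simp: support_on_def Fpow_def)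
  show "support_on I ` carrier (boolean_group I) \<subseteq> Fpow I"
    by (auto simp: carrier_boolean_group support_on_def Fpow_def)
  show "(\<lambda>X. \<lambda>i\<in>I. if i \<in> X then 1 else 0) ` Fpow I \<subseteq> carrier (boolean_group I)"
  proof
    fix x :: "'a \<Rightarrow> int"
    assume "x \<in> (\<lambda>X. \<lambda>i\<in>I. if i \<in> X then 1 else 0) ` Fpow I"
    then obtain X where X: "X \<subseteq> I" "finite X" and x: "x = (\<lambda>i\<in>I. if i \<in> X then 1 else 0)"
      by (auto simp: Fpow_def)
    have "{i \<in> I. x i \<noteq> 0} = X"
      using X unfolding x by auto
    moreover have "x \<in> I \<rightarrow>\<^sub>E {0..<2}"
      unfolding x by auto
    ultimately show "x \<in> carrier (boolean_group I)"
      using X by (simp add: carrier_boolean_group)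
  qed
qed

lemma support_on_one: "support_on I \<one>\<^bsub>boolean_group I\<^esub> = {}"
  by (auto simp: boolean_group_def support_on_def)

lemma support_on_mult:
  assumes "x \<in> carrier (boolean_group I)" and "y \<in> carrier (boolean_group I)"
  shows "support_on I (x \<otimes>\<^bsub>boolean_group I\<^esub> y) = sym_diff (support_on I x) (support_on I y)"
proof -
  have "(x \<otimes>\<^bsub>boolean_group I\<^esub> y) i \<noteq> 0 \<longleftrightarrow> (x i \<noteq> 0) \<noteq> (y i \<noteq> 0)" if "i \<in> I" for i
    using boolean_group_value[OF assms(1) that] boolean_group_value[OF assms(2) that] that
    by (auto simp: boolean_group_def mult_integer_mod_group)
  then show ?thesis
    unfolding support_on_def by auto
qed

theorem theorem7:
  fixes I :: "'i set"
  shows "natural_group (boolean_group I)"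
proof -
  let ?G = "boolean_group I"
  interpret G: group ?G by (rule group_boolean_group)
  obtain r where r: "well_order_on I r"
    using well_order_on by blast
  define R where "R = r - Id"
  have R: "wf R" "total_on I R" "R \<subseteq> I \<times> I"
    using r unfolding R_def well_order_on_def linear_order_on_def
      partial_order_on_def preorder_on_def refl_on_def by auto
  obtain p :: "'i \<Rightarrow> bool" where alt:
    "\<And>a c. \<lbrakk>(a, c) \<in> R; p a = p c\<rbrakk> \<Longrightarrow> \<exists>s. (a, s) \<in> R \<and> (s, c) \<in> R \<and> p s \<noteq> p a"
    by (rule ex_alternating_parity[OF R]) blast
  define S where "S = support_on I"
  define d where "d x y = code_dist R p (S x) (S y)" for x y
  have bij: "bij_betw S (carrier ?G) (Fpow I)"
    unfolding S_def by (rule bij_betw_support_on)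
  have S_eq_iff: "S x = S y \<longleftrightarrow> x = y" if "x \<in> carrier ?G" "y \<in> carrier ?G" for x y
    using bij that by (auto simp: bij_betw_def inj_on_def)
  show ?thesis
  proof (rule natural_groupI_rigid[OF group_boolean_group])
    show "Metric_space (carrier ?G) d"
    proof
      show "0 \<le> d x y" for x y
        by (simp add: d_def code_dist_nonneg)
      show "d x y = d y x" for x y
        by (simp add: d_def code_dist_commute)
      show "d x y = 0 \<longleftrightarrow> x = y" if "x \<in> carrier ?G" "y \<in> carrier ?G" for x y
        using S_eq_iff[OF that] by (simp add: d_def code_dist_eq_0_iff)
      show "d x z \<le> d x y + d y z" for x y z
        by (simp add: d_def code_dist_triangle)
    qed
    show "right_translations_isometric ?G d"
      unfolding right_translations_isometric_def self_isometry_def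
    proof (intro ballI conjI)
      fix a assume a: "a \<in> carrier ?G"
      show "bij_betw (\<lambda>x. x \<otimes>\<^bsub>?G\<^esub> a) (carrier ?G) (carrier ?G)"
        using a
        by (intro bij_betw_byWitness[where f' = "\<lambda>x. x \<otimes>\<^bsub>?G\<^esub> inv\<^bsub>?G\<^esub> a"])
          (auto simp: G.m_assoc)
      fix x y assume xy: "x \<in> carrier ?G" "y \<in> carrier ?G"
      have "sym_diff (sym_diff X A) (sym_diff Y A) = sym_diff X Y" for X Y A :: "'i set"
        by blast
      moreover have "sym_diff X A = sym_diff Y A \<longleftrightarrow> X = Y" for X Y A :: "'i set"
        by blast
      ultimately show "d (x \<otimes>\<^bsub>?G\<^esub> a) (y \<otimes>\<^bsub>?G\<^esub> a) = d x y"
        using a xy by (simp add: d_def S_def support_on_mult code_dist_def)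
    qed
    fix g x
    assume g: "self_isometry (carrier ?G) d g" "g \<one>\<^bsub>?G\<^esub> = \<one>\<^bsub>?G\<^esub>" and x: "x \<in> carrier ?G"
    \<comment> \<open>Conjugating \<open>g\<close> with \<open>S\<close> turns it into a map of finite subsets of \<open>I\<close>.\<close>
    define T where "T = the_inv_into (carrier ?G) S"
    have T: "bij_betw T (Fpow I) (carrier ?G)"
      unfolding T_def using bij by (rule bij_betw_the_inv_into)
    have ST: "S (T X) = X" if "X \<in> Fpow I" for X
      unfolding T_def using bij that by (simp add: bij_betw_def f_the_inv_into_f)
    have TS: "T (S z) = z" if "z \<in> carrier ?G" for z
      unfolding T_def using bij that by (simp add: bij_betw_def the_inv_into_f_f)
    have T_closed: "T X \<in> carrier ?G" if "X \<in> Fpow I" for X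
      using T that by (auto simp: bij_betw_def)
    have g_closed: "g z \<in> carrier ?G" if "z \<in> carrier ?G" for z
      using g that by (auto simp: self_isometry_def bij_betw_def)
    have Sx: "S x \<in> Fpow I"
      using bij x by (auto simp: bij_betw_def)
    have "(S \<circ> g \<circ> T) (S x) = S x"
    proof (rule set_code_isometry_eq_id[OF R alt _ _ _ Sx])
      show "bij_betw (S \<circ> g \<circ> T) (Fpow I) (Fpow I)"
        using T g bij unfolding self_isometry_def by (blast intro: bij_betw_trans)
      show "set_code R p (sym_diff ((S \<circ> g \<circ> T) X) ((S \<circ> g \<circ> T) Y)) = set_code R p (sym_diff X Y)"
        if XY: "X \<in> Fpow I" "Y \<in> Fpow I" for X Y
      proof (rule code_dist_eqD)
        have "d (g (T X)) (g (T Y)) = d (T X) (T Y)"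
          using g XY T_closed unfolding self_isometry_def by blast
        then show "code_dist R p ((S \<circ> g \<circ> T) X) ((S \<circ> g \<circ> T) Y) = code_dist R p X Y"
          using ST XY by (simp add: d_def)
      qed
      have "S \<one>\<^bsub>?G\<^esub> = {}"
        unfolding S_def by (rule support_on_one)
      then have "T {} = \<one>\<^bsub>?G\<^esub>"
        using TS by (metis G.one_closed)
      then show "(S \<circ> g \<circ> T) {} = {}"
        using g \<open>S \<one>\<^bsub>?G\<^esub> = {}\<close> by simp
    qed
    then have "S (g x) = S x"
      using TS x by simp
    then show "g x = x"
      using S_eq_iff g_closed x by blast
  qed
qed

end
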